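(* For every natural number $k$ and all real numbers $\varepsilon,\delta>0$, there are natural numbers $n=n(k,\varepsilon,\delta)$, $r=r(k,\varepsilon,\delta)$, $s=s(k,\varepsilon,\delta)$ and a real number $\eta=\eta(k,\varepsilon,\delta)>0$ with the following property: if $G=(U,V,E)$ is any finite bipartite graph with $|G|\geq n$ and $|\mathcal{H}_k(E)|<\eta\cdot|G|^{2k}$, then $U$ can be partitioned into sets $U_0,U_1,\ldots,U_r$ and $V$ into sets $V_0,V_1,\ldots,V_s$ with $$|U_0|<\delta\cdot|U|\quad\text{and}\quad |V_0|<\delta\cdot|V|$$ such that for every $i,j\geq 1$ the relation $E|_{U_i\times V_j}$ is $\varepsilon$-homogeneous.
   Context: A finite bipartite graph $G=(U,V,E)$ has vertex set partitioned into $U$ and $V$ and edge relation $E\subseteq U\times V$; $|G|$ denotes $|U\cup V|$. For $k\in\mathbb{N}$, $\mathcal{H}_k(E)$ is the set of half-graphs of height $k$: the set of tuples $(a_1,b_1,\ldots,a_k,b_k)$ with $a_i\in U$, $b_j\in V$ such that $(a_i,b_j)\in E$ if and only if $i\leq j$. For $X\subseteq U$, $Y\subseteq V$, the relation $E|_{X\times Y}$ is $\varepsilon$-homogeneous if either $|E\cap(X\times Y)|\geq(1-\varepsilon)^2|X\times Y|$ or $|(X\times Y)\setminus E|\geq(1-\varepsilon)^2|X\times Y|$.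
   Formalization: The bound |H_k(E)| < η|G|^{2k} is replaced by |H_k(E)| < η|U×V|^k (the original fails for very unbalanced graphs, e.g. a set and its power set with membership), and ε is restricted to 0 < ε < 2 (the claim fails for ε ≥ 2). *)

theory Defs
  imports Complex_Main "HOL-Library.Disjoint_Sets"
begin

definition finite_bipartite_graph :: "'a set \<Rightarrow> 'a set \<Rightarrow> ('a \<times> 'a) set \<Rightarrow> bool" where
  "finite_bipartite_graph U V E \<longleftrightarrow> finite U \<and> finite V \<and> U \<inter> V = {} \<and> E \<subseteq> U \<times> V"

text \<open>The tuple (a1, b1, ..., ak, bk) is encoded as the list [(a1, b1), ..., (ak, bk)],
  indexed from 0.\<close>

definition half_graphs :: "nat \<Rightarrow> 'a set \<Rightarrow> 'a set \<Rightarrow> ('a \<times> 'a) set \<Rightarrow> ('a \<times> 'a) list set" where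
  "half_graphs k U V E =
     {p. length p = k \<and> set p \<subseteq> U \<times> V \<and>
         (\<forall>i<k. \<forall>j<k. (fst (p ! i), snd (p ! j)) \<in> E \<longleftrightarrow> i \<le> j)}"

definition homogeneous :: "real \<Rightarrow> ('a \<times> 'a) set \<Rightarrow> 'a set \<Rightarrow> 'a set \<Rightarrow> bool" where
  "homogeneous \<epsilon> E X Y \<longleftrightarrow>
     real (card (E \<inter> (X \<times> Y))) \<ge> (1 - \<epsilon>)\<^sup>2 * real (card (X \<times> Y)) \<or>
     real (card ((X \<times> Y) - E)) \<ge> (1 - \<epsilon>)\<^sup>2 * real (card (X \<times> Y))"

text \<open>Parts may be empty: the number of parts has to be independent of the graph, whereas one side
  of a large graph may have very few vertices.\<close>

definition indexed_partition :: "'a set \<Rightarrow> nat \<Rightarrow> (nat \<Rightarrow> 'a set) \<Rightarrow> bool" where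
  "indexed_partition S r P \<longleftrightarrow> disjoint_family_on P {..r} \<and> (\<Union>i\<le>r. P i) = S"

text \<open>The half-graph count below is compared with the number of all tuples of k pairs in U x V,
  and not with the 2k-th power of the size of the union of U and V. With the latter normalisation,
  the hypothesis holds for every graph in which one side is small compared with the other, and
  the regularity statement fails (take a set and its power set, with membership as edge relation).
  If U and V have comparable sizes, the two normalisations agree up to a constant factor.
  The bound \<open>\<epsilon> < 2\<close> is needed because \<open>(1 - \<epsilon>)\<^sup>2 \<ge> 1\<close> for \<open>\<epsilon> \<ge> 2\<close>.\<close>

end

theory Submission
  imports Defs
begin

text \<open>Call \<open>X \<subseteq> U\<close> good if all but few \<open>v \<in> V\<close> are adjacent to almost all or to almost none of
  the vertices of \<open>X\<close>. If a large set has no large good subset, then splitting it repeatedly along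
  vertices of \<open>V\<close> gives, with positive density, binary trees of any prescribed depth, and a
  Ramsey argument on these trees as in Hodges' proof that bounded order bounds the tree rank
  gives a positive density of half-graphs. Keeping the density threshold inside the definition of the
  rank makes the counting automatic. Hence if there are few half-graphs, good sets can be split off
  greedily until less than \<open>\<delta> |U|\<close> is left. Their number does not depend on how small the exceptional
  sets are, so the union of these can be taken as the exceptional part of \<open>V\<close>, and the rest
  of \<open>V\<close> is partitioned according to which of the good sets a vertex is mostly adjacent to.\<close>

section \<open>Tree rank with counted splittings\<close>

definition nbrs :: "('a \<times> 'b) set \<Rightarrow> 'b \<Rightarrow> 'a set" where
  "nbrs E v = {u. (u, v) \<in> E}"

text \<open>A quantitative form of Shelah's 2-rank: each node of the binary tree has at least
  \<open>\<sigma>\<close> admissible labels instead of one, and the leaves have size at least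
  \<open>m\<close>. Both thresholds are absolute numbers rather than densities, so they keep their
  meaning when \<open>X\<close> and \<open>Y\<close> shrink.\<close>

fun rank_ge :: "('a \<times> 'b) set \<Rightarrow> real \<Rightarrow> real \<Rightarrow> nat \<Rightarrow> 'a set \<Rightarrow> 'b set \<Rightarrow> bool" where
  "rank_ge E \<sigma> m 0 X Y \<longleftrightarrow> m \<le> real (card X)"
| "rank_ge E \<sigma> m (Suc d) X Y \<longleftrightarrow>
     \<sigma> \<le> real (card {v \<in> Y. rank_ge E \<sigma> m d (X \<inter> nbrs E v) Y \<and> rank_ge E \<sigma> m d (X - nbrs E v) Y})"

lemma rank_ge_mono:
  assumes "rank_ge E \<sigma> m d X Y" "X \<subseteq> X'" "finite X'" "finite Y" "\<sigma>' \<le> \<sigma>"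
  shows "rank_ge E \<sigma>' m d X' Y"
  using assms
proof (induction d arbitrary: X X')
  case 0
  then show ?case
    using card_mono[of X' X] by simp
next
  case (Suc d)
  have "{v \<in> Y. rank_ge E \<sigma> m d (X \<inter> nbrs E v) Y \<and> rank_ge E \<sigma> m d (X - nbrs E v) Y}
    \<subseteq> {v \<in> Y. rank_ge E \<sigma>' m d (X' \<inter> nbrs E v) Y \<and> rank_ge E \<sigma>' m d (X' - nbrs E v) Y}"
  proof (clarify, intro conjI)
    fix v
    assume "rank_ge E \<sigma> m d (X \<inter> nbrs E v) Y" "rank_ge E \<sigma> m d (X - nbrs E v) Y"
    then show "rank_ge E \<sigma>' m d (X' \<inter> nbrs E v) Y" "rank_ge E \<sigma>' m d (X' - nbrs E v) Y"
      using Suc.prems by (auto intro: Suc.IH)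
  qed
  from card_mono[OF _ this] \<open>finite Y\<close> Suc.prems show ?case
    by simp
qed

text \<open>Since \<open>\<sigma>\<close> is positive, every level offers a label, so a branch can
  be followed down to a leaf, and leaves are subsets of \<open>X\<close>.\<close>

lemma rank_ge_card:
  assumes "rank_ge E \<sigma> m d X Y" "finite X" "0 < \<sigma>"
  shows "m \<le> real (card X)"
  using assms
proof (induction d arbitrary: X)
  case (Suc d)
  then have "{v \<in> Y. rank_ge E \<sigma> m d (X \<inter> nbrs E v) Y \<and> rank_ge E \<sigma> m d (X - nbrs E v) Y} \<noteq> {}"
    by (intro notI) simp
  then obtain v where "rank_ge E \<sigma> m d (X \<inter> nbrs E v) Y"
    by blast
  then have "m \<le> real (card (X \<inter> nbrs E v))"
    using Suc by blast
  also have "\<dots> \<le> real (card X)"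
    using Suc.prems by (simp add: card_mono)
  finally show ?case .
qed simp

text \<open>The Ramsey property of trees. At least half of the root labels lie in one part, say
  \<open>Y1\<close>. By induction each child of such a root has rank \<open>p - 1\<close> over
  \<open>Y1\<close> or rank \<open>q\<close> over \<open>Y2\<close>. The second case for one child
  passes up to \<open>X\<close> by monotonicity; otherwise all these labels are roots of a tree over
  \<open>Y1\<close>. The induction hypothesis is always applied with the full
  \<open>\<sigma>\<close>, so the threshold is halved once and not at every level.\<close>

lemma rank_ge_union:
  assumes "rank_ge E \<sigma> m (p + q) X (Y1 \<union> Y2)" "finite X" "finite Y1" "finite Y2" "0 < \<sigma>"
  shows "rank_ge E (\<sigma> / 2) m p X Y1 \<or> rank_ge E (\<sigma> / 2) m q X Y2"
  using assms
proof (induction "p + q" arbitrary: p q X)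
  case 0
  then show ?case by simp
next
  case (Suc d)
  show ?case
  \<comment> \<open>A tree of depth 0 asks only for \<open>m\<close> vertices in
    \<open>X\<close>.\<close>
  proof (cases "p = 0 \<or> q = 0")
    case True
    moreover have "m \<le> real (card X)"
      using rank_ge_card[OF Suc.prems(1)] Suc.prems by simp
    ultimately show ?thesis
      by auto
  next
    case False
    then obtain p' q' where pq: "p = Suc p'" "q = Suc q'"
      by (meson not0_implies_Suc)
    \<comment> \<open>A root in \<open>Y1\<close> uses up one level of \<open>p\<close>, a root in
      \<open>Y2\<close> one level of \<open>q\<close>; hence the induction on the sum.\<close>
    then have d: "d = p' + q" "d = p + q'"
      using Suc.hyps by auto
    define S where "S = {v \<in> Y1 \<union> Y2. rank_ge E \<sigma> m d (X \<inter> nbrs E v) (Y1 \<union> Y2) \<and>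
      rank_ge E \<sigma> m d (X - nbrs E v) (Y1 \<union> Y2)}"
    have "\<sigma> \<le> real (card S)"
      using Suc.prems(1) unfolding S_def Suc.hyps(2)[symmetric] by simp
    also have "S = (S \<inter> Y1) \<union> (S \<inter> Y2)"
      unfolding S_def by blast
    then have "card S \<le> card (S \<inter> Y1) + card (S \<inter> Y2)"
      by (metis card_Un_le)
    finally have "\<sigma> / 2 \<le> real (card (S \<inter> Y1)) \<or> \<sigma> / 2 \<le> real (card (S \<inter> Y2))"
      by linarith
    moreover have ?thesis if *: "\<sigma> / 2 \<le> real (card (S \<inter> Y1))"
    proof (rule disjCI)
      assume neg: "\<not> rank_ge E (\<sigma> / 2) m q X Y2"
      have sub: "rank_ge E (\<sigma> / 2) m p' X' Y1"
        if "rank_ge E \<sigma> m d X' (Y1 \<union> Y2)" "X' \<subseteq> X" for X'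
      proof -
        have "finite X'"
          using that Suc.prems finite_subset by blast
        then have "rank_ge E (\<sigma> / 2) m p' X' Y1 \<or> rank_ge E (\<sigma> / 2) m q X' Y2"
          using Suc.hyps(1)[OF d(1)] that d Suc.prems by simp
        then show ?thesis
          using neg rank_ge_mono[of E "\<sigma> / 2" m q X' Y2 X] that Suc.prems by auto
      qed
      have "S \<inter> Y1 \<subseteq> {v \<in> Y1. rank_ge E (\<sigma> / 2) m p' (X \<inter> nbrs E v) Y1 \<and>
          rank_ge E (\<sigma> / 2) m p' (X - nbrs E v) Y1}"
        using sub unfolding S_def by auto
      from card_mono[OF _ this] * Suc.prems show "rank_ge E (\<sigma> / 2) m p X Y1"
        unfolding pq by simp
    qed
    moreover have ?thesis if *: "\<sigma> / 2 \<le> real (card (S \<inter> Y2))"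
    proof (subst disj_commute, rule disjCI)
      assume neg: "\<not> rank_ge E (\<sigma> / 2) m p X Y1"
      have sub: "rank_ge E (\<sigma> / 2) m q' X' Y2"
        if "rank_ge E \<sigma> m d X' (Y1 \<union> Y2)" "X' \<subseteq> X" for X'
      proof -
        have "finite X'"
          using that Suc.prems finite_subset by blast
        then have "rank_ge E (\<sigma> / 2) m p X' Y1 \<or> rank_ge E (\<sigma> / 2) m q' X' Y2"
          using Suc.hyps(1)[OF d(2)] that d Suc.prems by simp
        then show ?thesis
          using neg rank_ge_mono[of E "\<sigma> / 2" m p X' Y1 X] that Suc.prems by auto
      qed
      have "S \<inter> Y2 \<subseteq> {v \<in> Y2. rank_ge E (\<sigma> / 2) m q' (X \<inter> nbrs E v) Y2 \<and>
          rank_ge E (\<sigma> / 2) m q' (X - nbrs E v) Y2}"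
        using sub unfolding S_def by auto
      from card_mono[OF _ this] * Suc.prems show "rank_ge E (\<sigma> / 2) m q X Y2"
        unfolding pq by simp
    qed
    ultimately show ?thesis
      by blast
  qed
qed

section \<open>Counting half-graphs in trees\<close>

text \<open>Half-graphs with one more vertex on the left side: they can be extended by a pair of vertices
  at either end.\<close>

definition ladders :: "nat \<Rightarrow> ('a \<times> 'b) set \<Rightarrow> 'a set \<Rightarrow> 'b set \<Rightarrow> ('a list \<times> 'b list) set" where
  "ladders k E X Y = {(as, bs). length as = Suc k \<and> length bs = k \<and> set as \<subseteq> X \<and> set bs \<subseteq> Y \<and>
     (\<forall>i\<le>k. \<forall>j<k. (as ! i, bs ! j) \<in> E \<longleftrightarrow> i \<le> j)}"

lemma finite_ladders:
  assumes "finite X" "finite Y"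
  shows "finite (ladders k E X Y)"
proof (rule finite_subset)
  show "ladders k E X Y \<subseteq> {as. set as \<subseteq> X \<and> length as = Suc k} \<times> {bs. set bs \<subseteq> Y \<and> length bs = k}"
    by (auto simp: ladders_def)
qed (use assms in \<open>auto intro: finite_lists_length_eq\<close>)

text \<open>A pair placed first needs \<open>h\<close> adjacent to all right vertices and
  \<open>x\<close> to no left vertex but \<open>h\<close>. The two restricted vertex sets ensure
  exactly this.\<close>

lemma ladders_Cons:
  assumes "(as, bs) \<in> ladders k E (X - nbrs E x) {y \<in> Y. (h, y) \<in> E}"
    and "h \<in> X" "x \<in> Y" "(h, x) \<in> E"
  shows "(h # as, x # bs) \<in> ladders (Suc k) E X Y"
proof -
  have "(as ! i, x) \<notin> E" if "i \<le> k" for i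
  proof -
    have "as ! i \<in> set as" "set as \<subseteq> X - nbrs E x"
      using assms(1) that by (auto simp: ladders_def)
    then show ?thesis
      by (auto simp: nbrs_def)
  qed
  moreover have "(h, bs ! j) \<in> E" if "j < k" for j
  proof -
    have "bs ! j \<in> set bs" "set bs \<subseteq> {y \<in> Y. (h, y) \<in> E}"
      using assms(1) that by (auto simp: ladders_def)
    then show ?thesis
      by auto
  qed
  ultimately show ?thesis
    using assms by (auto simp: ladders_def nth_Cons split: nat.splits)
qed

text \<open>The mirror case: a left vertex placed last is adjacent to no right vertex, while the
  last right vertex is adjacent to all left vertices but the last.\<close>

lemma ladders_append:
  assumes "(as, bs) \<in> ladders k E (X \<inter> nbrs E x) {y \<in> Y. (h, y) \<notin> E}"
    and "h \<in> X" "x \<in> Y" "(h, x) \<notin> E"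
  shows "(as @ [h], bs @ [x]) \<in> ladders (Suc k) E X Y"
proof -
  have "(as ! i, x) \<in> E" if "i \<le> k" for i
  proof -
    have "as ! i \<in> set as" "set as \<subseteq> X \<inter> nbrs E x"
      using assms(1) that by (auto simp: ladders_def)
    then show ?thesis
      by (auto simp: nbrs_def)
  qed
  moreover have "(h, bs ! j) \<notin> E" if "j < k" for j
  proof -
    have "bs ! j \<in> set bs" "set bs \<subseteq> {y \<in> Y. (h, y) \<notin> E}"
      using assms(1) that by (auto simp: ladders_def)
    then show ?thesis
      by auto
  qed
  ultimately show ?thesis
    using assms by (auto simp: ladders_def nth_append less_Suc_eq le_Suc_eq)
qed

text \<open>Counts extensions without repetition: by injectivity of \<open>f\<close>, the new pair
  and the old ladder can be read off the extended ladder.\<close>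

lemma sum_ladders_le:
  fixes E :: "('a \<times> 'b) set"
  assumes fin: "finite X" "finite Y"
    and sub: "\<And>h x. h \<in> X \<Longrightarrow> finite (F h x)"
    and inj: "inj (\<lambda>(h, x, p). f h x p)"
    and mem: "\<And>h x p. h \<in> X \<Longrightarrow> x \<in> D h \<Longrightarrow> p \<in> F h x \<Longrightarrow> f h x p \<in> ladders (Suc k) E X Y"
    and D: "\<And>h. D h \<subseteq> Y"
  shows "(\<Sum>h\<in>X. \<Sum>x\<in>D h. card (F h x)) \<le> card (ladders (Suc k) E X Y)"
proof -
  have finD: "finite (D h)" for h
    using D fin finite_subset by blast
  have "(\<Sum>h\<in>X. \<Sum>x\<in>D h. card (F h x)) = card (SIGMA h:X. SIGMA x:D h. F h x)"
    using fin finD sub by simp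
  also have "\<dots> \<le> card (ladders (Suc k) E X Y)"
  proof (rule card_inj_on_le)
    show "inj_on (\<lambda>(h, x, p). f h x p) (SIGMA h:X. SIGMA x:D h. F h x)"
      using inj inj_on_subset by blast
    show "finite (ladders (Suc k) E X Y)"
      using fin by (rule finite_ladders)
  qed (use mem in auto)
  finally show ?thesis .
qed

text \<open>Fix any \<open>h\<close> in \<open>X\<close> and colour \<open>Y\<close> by adjacency to
  \<open>h\<close>. One colour class still carries a tree one level deeper than the induction
  hypothesis needs. Each of its many root labels \<open>x\<close> has a side of \<open>X\<close>
  that fits an extension by \<open>(h, x)\<close>, at the front or at the end according to the
  colour, and the ladders inside that side are counted by induction.\<close>

lemma card_ladders_ge:
  "\<exists>d. \<exists>c>0. \<forall>(E::('a \<times> 'b) set) X Y \<sigma> m. finite X \<longrightarrow> finite Y \<longrightarrow> 0 < \<sigma> \<longrightarrow> 0 < m \<longrightarrow>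
     rank_ge E \<sigma> m d X Y \<longrightarrow> c * m ^ Suc k * \<sigma> ^ k \<le> real (card (ladders k E X Y))"
proof (induction k)
  case 0
  have "ladders 0 E X Y = (\<lambda>u. ([u], [])) ` X" for E :: "('a \<times> 'b) set" and X Y
    by (auto simp: ladders_def length_Suc_conv)
  then have "card (ladders 0 E X Y) = card X" for E :: "('a \<times> 'b) set" and X Y
    by (simp add: card_image inj_on_def)
  then show ?case
    by (intro exI[of _ 0] exI[of _ 1]) simp
next
  case (Suc k)
  then obtain d c where c: "c > 0" and IH: "\<And>(E::('a \<times> 'b) set) X Y \<sigma> m. finite X \<Longrightarrow> finite Y \<Longrightarrow>
      0 < \<sigma> \<Longrightarrow> 0 < m \<Longrightarrow> rank_ge E \<sigma> m d X Y \<Longrightarrow> c * m ^ Suc k * \<sigma> ^ k \<le> real (card (ladders k E X Y))"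
    by blast
  show ?case
  \<comment> \<open>Depth \<open>Suc d\<close> must survive in whichever colour occurs, hence the
    doubling. In the constant, \<open>2 ^ k\<close> comes from using the induction hypothesis with
    \<open>\<sigma> / 2\<close>, one factor 2 from the number \<open>\<sigma> / 2\<close> of root
    labels, and the other from the two ways of extending.\<close>
  proof (intro exI[of _ "Suc d + Suc d"] exI[of _ "c / (4 * 2 ^ k)"] conjI allI impI)
    show "0 < c / (4 * 2 ^ k)"
      using c by simp
  next
    fix E :: "('a \<times> 'b) set" and X Y and \<sigma> m :: real
    assume fin: "finite X" "finite Y" and pos: "0 < \<sigma>" "0 < m"
      and rk: "rank_ge E \<sigma> m (Suc d + Suc d) X Y"
    define t where "t = c * m ^ Suc k * (\<sigma> / 2) ^ k"
    have t: "t > 0"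
      using c pos by (simp add: t_def)
    define D1 where "D1 h = {y \<in> Y. (h, y) \<in> E}" for h
    define D0 where "D0 h = {y \<in> Y. (h, y) \<notin> E}" for h
    define F1 where "F1 h x = ladders k E (X - nbrs E x) (D1 h)" for h x
    define F0 where "F0 h x = ladders k E (X \<inter> nbrs E x) (D0 h)" for h x
    have finD: "finite (D1 h)" "finite (D0 h)" for h
      using fin by (auto simp: D1_def D0_def)
    have finF: "finite (F1 h x)" "finite (F0 h x)" for h x
      unfolding F1_def F0_def using fin finD by (auto intro: finite_ladders)
    have S1: "(\<Sum>h\<in>X. \<Sum>x\<in>D1 h. card (F1 h x)) \<le> card (ladders (Suc k) E X Y)"
    proof (rule sum_ladders_le[where f = "\<lambda>h x (as, bs). (h # as, x # bs)"])
      show "inj (\<lambda>(h::'a, x::'b, p). (\<lambda>(as, bs). (h # as, x # bs)) p)"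
        by (auto simp: inj_on_def)
    qed (use fin finF in \<open>auto simp: F1_def D1_def intro: ladders_Cons\<close>)
    have S0: "(\<Sum>h\<in>X. \<Sum>x\<in>D0 h. card (F0 h x)) \<le> card (ladders (Suc k) E X Y)"
    proof (rule sum_ladders_le[where f = "\<lambda>h x (as, bs). (as @ [h], bs @ [x])"])
      show "inj (\<lambda>(h::'a, x::'b, p). (\<lambda>(as, bs). (as @ [h], bs @ [x])) p)"
        by (auto simp: inj_on_def)
    qed (use fin finF in \<open>auto simp: F0_def D0_def intro: ladders_append\<close>)
    \<comment> \<open>Here \<open>G x\<close> stands for the side of \<open>x\<close> that suits the
      colour class \<open>D\<close>; \<open>t\<close> is the number of ladders obtained by induction
      for one root label.\<close>
    have many: "\<sigma> / 2 * t \<le> (\<Sum>x\<in>D. real (card (ladders k E (G x) D)))"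
      if G: "\<And>x. x \<in> {v \<in> D. rank_ge E (\<sigma> / 2) m d (X \<inter> nbrs E v) D \<and>
          rank_ge E (\<sigma> / 2) m d (X - nbrs E v) D} \<Longrightarrow> rank_ge E (\<sigma> / 2) m d (G x) D"
        and GX: "\<And>x. G x \<subseteq> X"
        and rkD: "rank_ge E (\<sigma> / 2) m (Suc d) X D" and finD: "finite D" for D G
    proof -
      define S where "S = {v \<in> D. rank_ge E (\<sigma> / 2) m d (X \<inter> nbrs E v) D \<and>
          rank_ge E (\<sigma> / 2) m d (X - nbrs E v) D}"
      have "\<sigma> / 2 * t \<le> real (card S) * t"
        using rkD t by (simp add: S_def)
      also have "\<dots> = (\<Sum>x\<in>S. t)"
        by simp
      also have "\<dots> \<le> (\<Sum>x\<in>S. real (card (ladders k E (G x) D)))"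
      proof (rule sum_mono)
        fix x assume "x \<in> S"
        moreover have "finite (G x)"
          using GX fin finite_subset by blast
        ultimately show "t \<le> real (card (ladders k E (G x) D))"
          unfolding t_def using IH finD pos G by (simp add: S_def)
      qed
      also have "\<dots> \<le> (\<Sum>x\<in>D. real (card (ladders k E (G x) D)))"
        using finD by (intro sum_mono2) (auto simp: S_def)
      finally show ?thesis .
    qed
    have each: "\<sigma> / 2 * t \<le> (\<Sum>x\<in>D1 h. real (card (F1 h x))) + (\<Sum>x\<in>D0 h. real (card (F0 h x)))" for h
    proof -
      have "Y = D1 h \<union> D0 h"
        by (auto simp: D1_def D0_def)
      then have "rank_ge E (\<sigma> / 2) m (Suc d) X (D1 h) \<or> rank_ge E (\<sigma> / 2) m (Suc d) X (D0 h)"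
        using rk fin finD pos by (intro rank_ge_union) auto
      moreover have "\<sigma> / 2 * t \<le> (\<Sum>x\<in>D1 h. real (card (F1 h x)))"
        if "rank_ge E (\<sigma> / 2) m (Suc d) X (D1 h)"
        unfolding F1_def by (rule many) (use that finD in auto)
      moreover have "\<sigma> / 2 * t \<le> (\<Sum>x\<in>D0 h. real (card (F0 h x)))"
        if "rank_ge E (\<sigma> / 2) m (Suc d) X (D0 h)"
        unfolding F0_def by (rule many) (use that finD in auto)
      moreover have "0 \<le> (\<Sum>x\<in>D1 h. real (card (F1 h x)))" "0 \<le> (\<Sum>x\<in>D0 h. real (card (F0 h x)))"
        by (auto intro: sum_nonneg)
      ultimately show ?thesis
        by linarith
    qed
    \<comment> \<open>The vertex \<open>h\<close> was arbitrary, and there are at least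
      \<open>m\<close> choices for it.\<close>
    have "m * (\<sigma> / 2 * t) \<le> real (card X) * (\<sigma> / 2 * t)"
      using rank_ge_card[OF rk] fin pos t by simp
    also have "\<dots> = (\<Sum>h\<in>X. \<sigma> / 2 * t)"
      by simp
    also have "\<dots> \<le> (\<Sum>h\<in>X. (\<Sum>x\<in>D1 h. real (card (F1 h x))) + (\<Sum>x\<in>D0 h. real (card (F0 h x))))"
      using each by (rule sum_mono)
    also have "\<dots> = real (\<Sum>h\<in>X. \<Sum>x\<in>D1 h. card (F1 h x)) + real (\<Sum>h\<in>X. \<Sum>x\<in>D0 h. card (F0 h x))"
      by (simp add: sum.distrib)
    also have "\<dots> \<le> 2 * real (card (ladders (Suc k) E X Y))"
      using S1 S0 by linarith
    finally have "m * (\<sigma> / 2 * t) / 2 \<le> real (card (ladders (Suc k) E X Y))"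
      by simp
    also have "m * (\<sigma> / 2 * t) / 2 = c / (4 * 2 ^ k) * m ^ Suc (Suc k) * \<sigma> ^ Suc k"
      by (simp add: t_def power_divide)
    finally show "c / (4 * 2 ^ k) * m ^ Suc (Suc k) * \<sigma> ^ Suc k \<le> real (card (ladders (Suc k) E X Y))" .
  qed
qed

text \<open>Forgetting the extra left vertex leaves a half-graph, and at most \<open>card U\<close>
  vertices can have been forgotten. As \<open>zip\<close> truncates to the shorter list, it drops
  precisely this vertex.\<close>

lemma card_ladders_le_half_graphs:
  fixes E :: "('a \<times> 'a) set"
  assumes fin: "finite U" "finite V"
  shows "card (ladders k E U V) \<le> card (half_graphs k U V E) * card U"
proof -
  have "finite (half_graphs k U V E)"
    by (rule finite_subset[OF _ finite_lists_length_eq[of "U \<times> V" k]])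
      (use fin in \<open>auto simp: half_graphs_def\<close>)
  moreover have "inj_on (\<lambda>(as, bs). (zip as bs, last as)) (ladders k E U V)"
  proof (rule inj_onI, clarify)
    fix as bs as' bs'
    assume mem: "(as, bs) \<in> ladders k E U V" "(as', bs') \<in> ladders k E U V"
      and zip: "zip as bs = zip as' bs'" and last: "last as = last as'"
    have len: "length as = Suc k" "length bs = k" "length as' = Suc k" "length bs' = k"
      using mem by (auto simp: ladders_def)
    have "take k as = map fst (zip as bs)" "bs = map snd (zip as bs)"
      "take k as' = map fst (zip as' bs')" "bs' = map snd (zip as' bs')"
      using len by (simp_all add: map_fst_zip_take map_snd_zip_take)
    then have "take k as = take k as'" "bs = bs'"
      using zip by metis+
    moreover have "as = take k as @ [last as]" "as' = take k as' @ [last as']"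
      using len by (metis append_butlast_last_id butlast_conv_take diff_Suc_1 list.size(3) nat.distinct(1))+
    ultimately show "as = as' \<and> bs = bs'"
      using last by metis
  qed
  moreover have "(\<lambda>(as, bs). (zip as bs, last as)) ` ladders k E U V \<subseteq> half_graphs k U V E \<times> U"
  proof clarify
    fix as bs
    assume mem: "(as, bs) \<in> ladders k E U V"
    then have "as \<noteq> []"
      by (auto simp: ladders_def)
    then have "last as \<in> U"
      using mem last_in_set[of as] by (auto simp: ladders_def)
    moreover have "zip as bs \<in> half_graphs k U V E"
      using mem by (auto simp: ladders_def half_graphs_def dest: set_zip_leftD set_zip_rightD)
    ultimately show "zip as bs \<in> half_graphs k U V E \<and> last as \<in> U"
      by blast
  qed
  ultimately have "card (ladders k E U V) \<le> card (half_graphs k U V E \<times> U)"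
    using fin by (intro card_inj_on_le) auto
  then show ?thesis
    by (simp add: card_cartesian_product)
qed

section \<open>Extraction of good sets\<close>

definition splitters :: "real \<Rightarrow> ('a \<times> 'b) set \<Rightarrow> 'b set \<Rightarrow> 'a set \<Rightarrow> 'b set" where
  "splitters e E V X =
     {v \<in> V. e * real (card X) < real (card (X \<inter> nbrs E v)) \<and> e * real (card X) < real (card (X - nbrs E v))}"

text \<open>Both sides of a split keep more than the fraction \<open>e\<close> of the set, so
  through \<open>d\<close> levels the size stays at least \<open>m\<close> and \<open>bad\<close>
  supplies \<open>\<sigma>\<close> labels at every node.\<close>

lemma rank_ge_if_no_good:
  assumes "finite V" "e \<le> 1" "0 < e" "0 < m" "m \<le> e ^ d * real (card X)"
    and bad: "\<And>X'. X' \<subseteq> X \<Longrightarrow> m \<le> real (card X') \<Longrightarrow> \<sigma> \<le> real (card (splitters e E V X'))"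
  shows "rank_ge E \<sigma> m d X V"
  using assms
proof (induction d arbitrary: X)
  case 0
  then show ?case by simp
next
  case (Suc d)
  have step: "rank_ge E \<sigma> m d X' V" if "X' \<subseteq> X" "e * real (card X) < real (card X')" for X'
  proof (rule Suc.IH)
    have "m \<le> e ^ d * (e * real (card X))"
      using Suc.prems by (simp add: mult.assoc mult.commute mult.left_commute)
    also have "\<dots> \<le> e ^ d * real (card X')"
      using that Suc.prems by (intro mult_left_mono) auto
    finally show "m \<le> e ^ d * real (card X')" .
  qed (use Suc.prems that in auto)
  \<comment> \<open>This gives \<open>m \<le> card X\<close>, so that \<open>bad\<close> applies to
    \<open>X\<close> itself.\<close>
  have "e ^ Suc d * real (card X) \<le> 1 * real (card X)"
    using Suc.prems by (intro mult_right_mono power_le_one) auto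
  then have "\<sigma> \<le> real (card (splitters e E V X))"
    using Suc.prems by auto
  moreover have "splitters e E V X \<subseteq>
      {v \<in> V. rank_ge E \<sigma> m d (X \<inter> nbrs E v) V \<and> rank_ge E \<sigma> m d (X - nbrs E v) V}"
    using step by (auto simp: splitters_def)
  from card_mono[OF _ this] have "card (splitters e E V X) \<le>
      card {v \<in> V. rank_ge E \<sigma> m d (X \<inter> nbrs E v) V \<and> rank_ge E \<sigma> m d (X - nbrs E v) V}"
    using \<open>finite V\<close> by simp
  ultimately show ?case
    by simp
qed

text \<open>Empty sets have no splitters, so the extraction may continue with empty sets once less than
  \<open>\<delta> |U|\<close> is left.\<close>

lemma greedy_extraction:
  fixes good :: "'a set \<Rightarrow> bool"
  assumes "finite U" "good {}"
    and ex: "\<And>X. X \<subseteq> U \<Longrightarrow> b \<le> real (card X) \<Longrightarrow> \<exists>X'\<subseteq>X. m \<le> real (card X') \<and> good X'"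
  shows "\<exists>P. (\<forall>i\<in>{1..r}. P i \<subseteq> U \<and> good (P i)) \<and> disjoint_family_on P {1..r::nat} \<and>
    (real (card (U - (\<Union>i\<in>{1..r}. P i))) < b \<or> real r * m \<le> real (card (\<Union>i\<in>{1..r}. P i)))"
proof (induction r)
  case 0
  then show ?case by (simp add: disjoint_family_on_def)
next
  case (Suc r)
  then obtain P where P: "\<And>i. i \<in> {1..r} \<Longrightarrow> P i \<subseteq> U \<and> good (P i)" "disjoint_family_on P {1..r}"
    and size: "real (card (U - (\<Union>i\<in>{1..r}. P i))) < b \<or> real r * m \<le> real (card (\<Union>i\<in>{1..r}. P i))"
    by blast
  define W where "W = (\<Union>i\<in>{1..r}. P i)"
  have W: "W \<subseteq> U" "finite W"
  proof -
    show "W \<subseteq> U"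
      using P(1) by (auto simp: W_def simp del: atLeastAtMost_iff)
    then show "finite W"
      using \<open>finite U\<close> finite_subset by blast
  qed
  obtain Z where Z: "Z \<subseteq> U - W" "good Z" "real (card (U - W)) < b \<or> m \<le> real (card Z)"
    using ex[of "U - W"] \<open>good {}\<close> by (meson Diff_subset empty_subsetI not_less)
  have union: "(\<Union>i\<in>{1..Suc r}. (P(Suc r := Z)) i) = W \<union> Z"
    by (auto simp: W_def atLeastAtMostSuc_conv)
  have finZ: "finite Z"
    using Z(1) \<open>finite U\<close> finite_subset by blast
  have disj: "disjoint_family_on (P(Suc r := Z)) {1..Suc r}"
    using P(2) Z(1) by (force simp: disjoint_family_on_def W_def atLeastAtMostSuc_conv)
  have good: "\<forall>i\<in>{1..Suc r}. (P(Suc r := Z)) i \<subseteq> U \<and> good ((P(Suc r := Z)) i)"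
    using P(1) Z by auto
  have "real (card (U - (W \<union> Z))) < b \<or> real (Suc r) * m \<le> real (card (W \<union> Z))"
  proof (cases "real (card (U - W)) < b")
    case True
    have "card (U - (W \<union> Z)) \<le> card (U - W)"
      using \<open>finite U\<close> by (intro card_mono) auto
    with True show ?thesis by simp
  next
    case False
    moreover have "card (W \<union> Z) = card W + card Z"
      using W finZ Z by (intro card_Un_disjoint) auto
    ultimately show ?thesis
      using size Z(3) unfolding W_def[symmetric] by (simp add: algebra_simps)
  qed
  with disj good show ?case
    unfolding union[symmetric] by blast
qed

section \<open>Homogeneity from degrees\<close>

lemma card_Int_Times:
  fixes E :: "('a \<times> 'b) set"
  assumes "finite X" "finite Y"
  shows "card (E \<inter> (X \<times> Y)) = (\<Sum>v\<in>Y. card (X \<inter> nbrs E v))"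
proof -
  have "card (E \<inter> (X \<times> Y)) = card (SIGMA v:Y. X \<inter> nbrs E v)"
    by (rule bij_betw_same_card[of prod.swap])
      (auto simp: bij_betw_def inj_on_def nbrs_def intro!: rev_image_eqI)
  then show ?thesis
    using assms by simp
qed

text \<open>Degree bounds for the single \<open>v\<close> in \<open>Y\<close> add up to an edge
  count. The sparse case is the dense case for the complement \<open>- E\<close>.\<close>

lemma homogeneousI:
  assumes "finite X" "finite Y"
    and "(\<forall>v\<in>Y. real (card (X - nbrs E v)) \<le> (1 - (1 - \<epsilon>)\<^sup>2) * real (card X)) \<or>
         (\<forall>v\<in>Y. real (card (X \<inter> nbrs E v)) \<le> (1 - (1 - \<epsilon>)\<^sup>2) * real (card X))"
  shows "homogeneous \<epsilon> E X Y"
proof -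
  have split: "real (card (X \<inter> nbrs F v)) + real (card (X - nbrs F v)) = real (card X)"
    for F :: "('a \<times> 'a) set" and v
    using assms(1) by (metis card_Int_Diff of_nat_add)
  have dense: "(1 - \<epsilon>)\<^sup>2 * real (card (X \<times> Y)) \<le> real (card (F \<inter> (X \<times> Y)))"
    if "\<forall>v\<in>Y. real (card (X - nbrs F v)) \<le> (1 - (1 - \<epsilon>)\<^sup>2) * real (card X)" for F
  proof -
    have "(1 - \<epsilon>)\<^sup>2 * real (card (X \<times> Y)) = (\<Sum>v\<in>Y. (1 - \<epsilon>)\<^sup>2 * real (card X))"
      by (simp add: card_cartesian_product)
    also have "\<dots> \<le> (\<Sum>v\<in>Y. real (card (X \<inter> nbrs F v)))"
    proof (rule sum_mono)
      fix v assume "v \<in> Y"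
      with that have "real (card (X - nbrs F v)) \<le> (1 - (1 - \<epsilon>)\<^sup>2) * real (card X)" by blast
      with split[of F v] show "(1 - \<epsilon>)\<^sup>2 * real (card X) \<le> real (card (X \<inter> nbrs F v))"
        by (simp add: algebra_simps)
    qed
    also have "\<dots> = real (card (F \<inter> (X \<times> Y)))"
      using assms by (simp add: card_Int_Times)
    finally show ?thesis .
  qed
  have "X - nbrs (- E) v = X \<inter> nbrs E v" "- E \<inter> (X \<times> Y) = X \<times> Y - E" for v
    by (auto simp: nbrs_def)
  then show ?thesis
    using assms(3) dense[of E] dense[of "- E"] by (auto simp: homogeneous_def)
qed

section \<open>Choice of constants and the two partitions\<close>

theorem theorem7p7:
  fixes k :: nat and \<epsilon> \<delta> :: real
  assumes "\<epsilon> > 0" and "\<epsilon> < 2" and "\<delta> > 0"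
  shows "\<exists>(n::nat) (r::nat) (s::nat) (\<eta>::real). \<eta> > 0 \<and>
    (\<forall>(U::'a set) (V::'a set) (E::('a \<times> 'a) set).
       finite_bipartite_graph U V E \<and> card (U \<union> V) \<ge> n \<and>
       real (card (half_graphs k U V E)) < \<eta> * real (card (U \<times> V)) ^ k \<longrightarrow>
       (\<exists>(P::nat \<Rightarrow> 'a set) (Q::nat \<Rightarrow> 'a set).
          indexed_partition U r P \<and> indexed_partition V s Q \<and>
          real (card (P 0)) < \<delta> * real (card U) \<and>
          real (card (Q 0)) < \<delta> * real (card V) \<and>
          (\<forall>i\<in>{1..r}. \<forall>j\<in>{1..s}. homogeneous \<epsilon> E (P i) (Q j))))"
proof -
  \<comment> \<open>The fraction of wrong pairs that homogeneity tolerates; it is positive because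
    \<open>0 < \<epsilon> < 2\<close>.\<close>
  define e where "e = 1 - (1 - \<epsilon>)\<^sup>2"
  have "(1 - \<epsilon>)\<^sup>2 < 1"
    using assms by (simp add: abs_square_less_1)
  then have e: "0 < e" "e \<le> 1"
    by (auto simp: e_def)
  obtain d c where c: "c > 0" and count: "\<And>(E::('a \<times> 'a) set) X Y \<sigma> m. finite X \<Longrightarrow> finite Y \<Longrightarrow>
      0 < \<sigma> \<Longrightarrow> 0 < m \<Longrightarrow> rank_ge E \<sigma> m d X Y \<Longrightarrow> c * m ^ Suc k * \<sigma> ^ k \<le> real (card (ladders k E X Y))"
    using card_ladders_ge[of k] by blast
  \<comment> \<open>A remainder of size \<open>\<delta> * card U\<close> shrinks by \<open>e\<close>
    at most \<open>d\<close> times, so it contains a good set of size at least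
    \<open>q * card U\<close>.\<close>
  define q where "q = e ^ d * \<delta>"
  have q: "q > 0"
    using e assms by (simp add: q_def)
  \<comment> \<open>So many disjoint sets of size \<open>q * card U\<close> do not fit into
    \<open>U\<close>.\<close>
  obtain r :: nat where r: "1 / q < real r"
    using reals_Archimedean2 by blast
  \<comment> \<open>Chosen after \<open>r\<close>, so that \<open>r\<close> exceptional sets of
    density \<open>\<tau>\<close> stay below \<open>\<delta>\<close> together; the
    \<open>+ 1\<close> makes this strict.\<close>
  define \<tau> where "\<tau> = \<delta> / (real r + 1)"
  have \<tau>: "\<tau> > 0" "real r * \<tau> < \<delta>"
    using assms by (auto simp: \<tau>_def field_simps)
  \<comment> \<open>The product is the density of ladders forced by rank \<open>d\<close>. The
    minimum with 1 makes the hypothesis contradictory for \<open>k = 0\<close>, where the empty list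
    is the only half-graph.\<close>
  define \<eta> where "\<eta> = min 1 (c * q ^ Suc k * \<tau> ^ k)"
  \<comment> \<open>The number \<open>2 ^ r\<close> counts the possible values of \<open>ty\<close>
    below.\<close>
  show ?thesis
  proof (rule exI[of _ 0], rule exI[of _ r], rule exI[of _ "2 ^ r"], rule exI[of _ \<eta>],
      intro conjI allI impI, goal_cases)
    case 1
    show ?case
      using c q \<tau> by (simp add: \<eta>_def)
  next
    case (2 U V E)
    then have fin: "finite U" "finite V"
      and few: "real (card (half_graphs k U V E)) < \<eta> * real (card (U \<times> V)) ^ k"
      by (auto simp: finite_bipartite_graph_def)
    have "k \<noteq> 0"
    proof
      assume "k = 0"
      then have "half_graphs k U V E = {[]}"
        by (auto simp: half_graphs_def)
      with few \<open>k = 0\<close> show False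
        by (simp add: \<eta>_def)
    qed
    \<comment> \<open>With \<open>k \<ge> 1\<close>, an empty side would make the strict upper bound
      0.\<close>
    with few have pos: "card U > 0" "card V > 0"
      by (auto simp: card_cartesian_product power_0_left intro!: Nat.gr0I)
    define m where "m = q * real (card U)"
    define \<sigma> where "\<sigma> = \<tau> * real (card V)"
    have m\<sigma>: "m > 0" "\<sigma> > 0"
      using q \<tau> pos by (auto simp: m_def \<sigma>_def)
    have "real (card (ladders k E U V)) \<le> real (card (half_graphs k U V E) * card U)"
      using card_ladders_le_half_graphs[OF fin] by (simp only: of_nat_le_iff)
    also have "\<dots> < \<eta> * real (card (U \<times> V)) ^ k * real (card U)"
      using few pos by simp
    also have "\<dots> \<le> c * q ^ Suc k * \<tau> ^ k * real (card (U \<times> V)) ^ k * real (card U)"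
      by (intro mult_right_mono) (auto simp: \<eta>_def)
    also have "\<dots> = c * m ^ Suc k * \<sigma> ^ k"
      by (simp add: m_def \<sigma>_def card_cartesian_product power_mult_distrib)
    finally have few_ladders: "real (card (ladders k E U V)) < c * m ^ Suc k * \<sigma> ^ k" .
    define good where "good X \<longleftrightarrow> real (card (splitters e E V X)) < \<sigma>" for X
    have "good {}"
      using m\<sigma> by (simp add: good_def splitters_def)
    \<comment> \<open>Without a good subset, \<open>X\<close> and hence \<open>U\<close> would have
      rank \<open>d\<close>, which forces more ladders than \<open>few_ladders\<close>
      permits.\<close>
    have ex: "\<exists>X'\<subseteq>X. m \<le> real (card X') \<and> good X'" if X: "X \<subseteq> U" "\<delta> * real (card U) \<le> real (card X)" for X
    proof (rule ccontr)
      assume none: "\<not> ?thesis"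
      have "m \<le> e ^ d * real (card X)"
        using X(2) e by (simp add: m_def q_def mult.assoc)
      then have "rank_ge E \<sigma> m d X V"
        using none fin e m\<sigma> by (intro rank_ge_if_no_good) (auto simp: good_def not_less)
      then have "rank_ge E \<sigma> m d U V"
        using X fin by (auto intro: rank_ge_mono)
      with count[of U V \<sigma> m E] few_ladders fin m\<sigma> show False
        by simp
    qed
    obtain P where P: "\<And>i. i \<in> {1..r} \<Longrightarrow> P i \<subseteq> U" "\<And>i. i \<in> {1..r} \<Longrightarrow> good (P i)"
      and disj: "disjoint_family_on P {1..r}"
      and size: "real (card (U - (\<Union>i\<in>{1..r}. P i))) < \<delta> * real (card U) \<or>
        real r * m \<le> real (card (\<Union>i\<in>{1..r}. P i))"
      using greedy_extraction[of U good "\<delta> * real (card U)" m r] \<open>good {}\<close> fin ex by blast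
    have finP: "finite (P i)" if "i \<in> {1..r}" for i
      using P(1)[OF that] fin finite_subset by blast
    have "real (card (\<Union>i\<in>{1..r}. P i)) \<le> real (card U)"
      unfolding of_nat_le_iff using P(1) fin by (intro card_mono UN_least)
    also have "\<dots> < real r * m"
      using r q pos by (simp add: m_def field_simps)
    finally have rest: "real (card (U - (\<Union>i\<in>{1..r}. P i))) < \<delta> * real (card U)"
      using size by linarith
    define P' where "P' i = (if i = 0 then U - (\<Union>i\<in>{1..r}. P i) else P i)" for i
    have ind: "{..n} = insert 0 {1..n}" for n :: nat
      by auto
    have partP: "indexed_partition U r P'"
      unfolding indexed_partition_def ind
    proof
      show "disjoint_family_on P' (insert 0 {1..r})"
        using disj by (fastforce simp: disjoint_family_on_def P'_def)
      show "(\<Union>i\<in>insert 0 {1..r}. P' i) = U"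
        using P(1) by (fastforce simp: P'_def)
    qed
    define B where "B = (\<Union>i\<in>{1..r}. splitters e E V (P i))"
    have "B \<subseteq> V"
      by (auto simp: B_def splitters_def)
    have "real (card B) \<le> real (\<Sum>i\<in>{1..r}. card (splitters e E V (P i)))"
      unfolding B_def of_nat_le_iff by (rule card_UN_le) simp
    also have "\<dots> = (\<Sum>i\<in>{1..r}. real (card (splitters e E V (P i))))"
      by simp
    also have "\<dots> \<le> (\<Sum>i\<in>{1..r}. \<sigma>)"
      using P(2) by (intro sum_mono) (auto simp: good_def less_imp_le)
    also have "\<dots> = real r * \<tau> * real (card V)"
      by (simp add: \<sigma>_def)
    also have "\<dots> < \<delta> * real (card V)"
      using \<tau> pos by (intro mult_strict_right_mono) auto
    finally have cardB: "real (card B) < \<delta> * real (card V)" .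
    \<comment> \<open>Numbers the subsets of \<open>{1..r}\<close>, so that each part of
      \<open>V\<close> collects the vertices of one value of \<open>ty\<close>.\<close>
    obtain g :: "nat \<Rightarrow> nat set" where g: "bij_betw g {1..2 ^ r} (Pow {1..r})"
      using ex_bij_betw_nat_finite_1[of "Pow {1..r}"] by (auto simp: card_Pow)
    define ty where "ty v = {i \<in> {1..r}. real (card (P i - nbrs E v)) \<le> e * real (card (P i))}" for v
    define Q where "Q j = (if j = 0 then B else {v \<in> V - B. ty v = g j})" for j
    have partQ: "indexed_partition V (2 ^ r) Q"
      unfolding indexed_partition_def ind
    proof
      have "g i \<noteq> g j" if "i \<in> {1..2 ^ r}" "j \<in> {1..2 ^ r}" "i \<noteq> j" for i j
        using g that by (auto simp: bij_betw_def inj_on_def)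
      then show "disjoint_family_on Q (insert 0 {1..2 ^ r})"
        unfolding disjoint_family_on_def by (auto simp: Q_def)
      have "\<exists>j\<in>{1..2 ^ r}. ty v = g j" for v
      proof -
        have "ty v \<in> g ` {1..2 ^ r}"
          using g by (auto simp: bij_betw_def ty_def)
        then show ?thesis by blast
      qed
      then show "(\<Union>j\<in>insert 0 {1..2 ^ r}. Q j) = V"
        using \<open>B \<subseteq> V\<close> by (fastforce simp: Q_def)
    qed
    have hom: "homogeneous \<epsilon> E (P' i) (Q j)" if i: "i \<in> {1..r}" and j: "j \<in> {1..2 ^ r}" for i j
    proof -
      have *: "P' i = P i" "Q j = {v \<in> V - B. ty v = g j}"
        using i j by (auto simp: P'_def Q_def)
      show ?thesis
        unfolding *
      proof (rule homogeneousI; (unfold e_def[symmetric])?)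
        show "finite (P i)" "finite {v \<in> V - B. ty v = g j}"
          using finP i fin by auto
        show "(\<forall>v\<in>{v \<in> V - B. ty v = g j}. real (card (P i - nbrs E v)) \<le> e * real (card (P i))) \<or>
          (\<forall>v\<in>{v \<in> V - B. ty v = g j}. real (card (P i \<inter> nbrs E v)) \<le> e * real (card (P i)))"
        proof (cases "i \<in> g j")
          case True
          then show ?thesis
            by (auto simp: ty_def)
        next
          case False
          have "real (card (P i \<inter> nbrs E v)) \<le> e * real (card (P i))" if "v \<in> V - B" "ty v = g j" for v
          proof -
            \<comment> \<open>Outside \<open>B\<close>, a vertex that misses more than the fraction
              \<open>e\<close> of \<open>P i\<close> can be adjacent to at most the fraction
              \<open>e\<close>.\<close>
            have "v \<notin> splitters e E V (P i)" "\<not> real (card (P i - nbrs E v)) \<le> e * real (card (P i))"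
              using that False i by (auto simp: B_def ty_def)
            then show ?thesis
              using that by (auto simp: splitters_def)
          qed
          then show ?thesis
            by blast
        qed
      qed
    qed
    have "real (card (P' 0)) < \<delta> * real (card U)" "real (card (Q 0)) < \<delta> * real (card V)"
      using rest cardB by (simp_all add: P'_def Q_def)
    with partP partQ hom show ?case
      by blast
  qed
qed

end
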